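(* Let $n,K\ge 1$ be integers, and let $\tilde\phi:\mathbb{R}^{2n}\to\mathbb{R}$ be the function defined by the network $$z_1=\sigma(W_1\tilde x+b_1),\qquad z_k=\sigma(W_kz_{k-1}+b_k+D_k\tilde x)\ \ (k=2,\ldots,K),\qquad \tilde\phi(\tilde x)=W_{K+1}z_K+b_{K+1}+D_{K+1}\tilde x,$$ where $\sigma:\mathbb{R}\to\mathbb{R}$ is applied entrywise and $W_k$, $D_k$, $b_k$ are real matrices and vectors of compatible dimensions. If all entries of $W_1,\ldots,W_{K+1}$ and of $D_2,\ldots,D_K$ are non-negative, and $\sigma$ is convex and non-decreasing (e.g., the ReLU function $\sigma(t)=\max\{t,0\}$), then $\tilde\phi(\tilde x)$ is supermodular in $\tilde x$.
   Context: For $x,y\in\mathbb{R}^N$ let $x\vee y$ and $x\wedge y$ denote the entrywise maximum and entrywise minimum. A function $f:D\to\mathbb{R}$, $D\subseteq\mathbb{R}^N$, is supermodular if $f(x)+f(y)\le f(x\vee y)+f(x\wedge y)$ for all $x,y\in D$. The network is called an input supermodular neural network (ISNN); in the paper it is fed with $\tilde x=[x^\top,(\mathbf 1-x)^\top]^\top\in\mathbb{R}^{2n}$ for $x\in\{0,1\}^n$, and supermodularity is understood with respect to the $2n$-dimensional vector $\tilde x$. The network has scalar output; $z_k$ is the output vector of hidden layer $k$, and the biases $b_k$ and the matrix $D_{K+1}$ are not restricted in sign. *)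

theory Defs
  imports "HOL-Analysis.Convex" "Jordan_Normal_Form.Matrix"
begin

definition vec_sup :: "real vec \<Rightarrow> real vec \<Rightarrow> real vec" where
  "vec_sup x y = vec (dim_vec x) (\<lambda>i. max (x $ i) (y $ i))"

definition vec_inf :: "real vec \<Rightarrow> real vec \<Rightarrow> real vec" where
  "vec_inf x y = vec (dim_vec x) (\<lambda>i. min (x $ i) (y $ i))"

(* S is meant to be a set of vectors of one common dimension that is closed under
   vec_sup and vec_inf, for instance carrier_vec N. *)
definition supermodular_on :: "real vec set \<Rightarrow> (real vec \<Rightarrow> real) \<Rightarrow> bool" where
  "supermodular_on S f \<longleftrightarrow>
     (\<forall>x\<in>S. \<forall>y\<in>S. f x + f y \<le> f (vec_sup x y) + f (vec_inf x y))"

(* The families W, D, b are indexed by the layer number k, starting from 1; the values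
   W 0, b 0, D 0 and D 1 are never used. The layer z_0 is the input itself, and z_1
   has no skip term. *)
fun isnn_layer ::
    "(real \<Rightarrow> real) \<Rightarrow> (nat \<Rightarrow> real mat) \<Rightarrow> (nat \<Rightarrow> real mat) \<Rightarrow> (nat \<Rightarrow> real vec) \<Rightarrow>
     real vec \<Rightarrow> nat \<Rightarrow> real vec" where
  "isnn_layer \<sigma> W D b x 0 = x"
| "isnn_layer \<sigma> W D b x (Suc 0) = map_vec \<sigma> (W 1 *\<^sub>v x + b 1)"
| "isnn_layer \<sigma> W D b x (Suc (Suc k)) =
     map_vec \<sigma> (W (k + 2) *\<^sub>v isnn_layer \<sigma> W D b x (Suc k) + b (k + 2) + D (k + 2) *\<^sub>v x)"

(* The output layer has one row; its single component is the scalar output. *)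
definition isnn ::
    "nat \<Rightarrow> (real \<Rightarrow> real) \<Rightarrow> (nat \<Rightarrow> real mat) \<Rightarrow> (nat \<Rightarrow> real mat) \<Rightarrow> (nat \<Rightarrow> real vec) \<Rightarrow>
     real vec \<Rightarrow> real" where
  "isnn K \<sigma> W D b x =
     (W (K + 1) *\<^sub>v isnn_layer \<sigma> W D b x K + b (K + 1) + D (K + 1) *\<^sub>v x) $ 0"

end

theory Submission
  imports Defs
begin

text \<open>Fix two inputs \<open>x\<close> and \<open>y\<close> and follow the network on the four inputs
  \<open>x\<close>, \<open>y\<close>, \<open>x \<and> y\<close> and \<open>x \<or> y\<close> (entrywise minimum and maximum).  For each neuron
  the pair of values at \<open>x\<close> and \<open>y\<close> is weakly majorized by the pair of values at the
  meet and the join: neither value exceeds the value at the join, and the sum over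
  \<open>x, y\<close> is at most the sum over meet and join.  The second condition alone is
  supermodularity, but it is not preserved by \<open>\<sigma>\<close>; the first condition, a trace of
  the monotonicity of the hidden layers, repairs this.

  For input coordinates weak majorization holds because
  \<open>min a b + max a b = a + b\<close>.  It is stable under everything that a hidden layer does:
  the quadruples in question form a convex cone, so non-negative weights preserve them;
  equal shifts, the biases, preserve them as well; and a convex non-decreasing
  function preserves them by the two-point case of the Tomic--Weyl inequality
  (\<open>weakly_majorized_convex_mono\<close>).  The output needs only the sum condition, and there
  the skip term may have any sign, because a linear map takes equal sums over
  \<open>x, y\<close> and over meet and join.\<close>

section \<open>Weak majorization of pairs\<close>

text \<open>The upper bound on \<open>a\<close> and \<open>b\<close> is \<open>q\<close>, the value at the join, in place of the
  \<open>max p q\<close> of the usual definition for unordered pairs.  Fixing this role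
  makes the condition a system of homogeneous linear inequalities, hence stable under
  addition; the condition with \<open>max p q\<close> is not.\<close>

definition weakly_majorized :: "real \<Rightarrow> real \<Rightarrow> real \<Rightarrow> real \<Rightarrow> bool" where
  "weakly_majorized a b p q \<longleftrightarrow> a \<le> q \<and> b \<le> q \<and> a + b \<le> p + q"

lemma weakly_majorized_const: "weakly_majorized c c c c"
  by (simp add: weakly_majorized_def)

lemma weakly_majorized_min_max: "weakly_majorized a b (min a b) (max a b)"
  by (simp add: weakly_majorized_def min_def max_def)

lemma weakly_majorized_add:
  assumes "weakly_majorized a b p q" and "weakly_majorized a' b' p' q'"
  shows "weakly_majorized (a + a') (b + b') (p + p') (q + q')"
  using assms by (simp add: weakly_majorized_def)

lemma weakly_majorized_mult_left:
  assumes "weakly_majorized a b p q" and "0 \<le> c"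
  shows "weakly_majorized (c * a) (c * b) (c * p) (c * q)"
  using assms
  by (auto simp: weakly_majorized_def mult_left_mono simp flip: distrib_left)

lemma weakly_majorized_sum:
  assumes "\<And>i. i \<in> I \<Longrightarrow> weakly_majorized (a i) (b i) (p i) (q i)"
  shows "weakly_majorized (sum a I) (sum b I) (sum p I) (sum q I)"
  using assms
  by (auto simp: weakly_majorized_def intro!: sum_mono simp flip: sum.distrib)

text \<open>A convex function can only grow in sum when two points are moved apart symmetrically:
  \<open>b\<close> and its mirror image \<open>p + q - b\<close> are convex combinations of \<open>p\<close> and \<open>q\<close>
  with swapped weights.\<close>

lemma convex_on_sum_mirror_le:
  fixes f :: "real \<Rightarrow> real"
  assumes f: "convex_on {p..q} f" and b: "p \<le> b" "b \<le> q"
  shows "f (p + q - b) + f b \<le> f p + f q"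
proof (cases "p = q")
  case True
  then show ?thesis using b by simp
next
  case False
  define t where "t = (b - p) / (q - p)"
  have compl_compl: "1 - (1 - t) = t" by simp
  have t: "0 \<le> t" "t \<le> 1" using False b by (auto simp: t_def field_simps)
  have "t * (q - p) = b - p" using False by (simp add: t_def)
  then have eqs: "(1 - t) * p + t * q = b" "t * p + (1 - t) * q = p + q - b"
    by (simp_all add: algebra_simps)
  have "f b \<le> (1 - t) * f p + t * f q"
    using convex_onD[OF f, of t p q, unfolded real_scaleR_def eqs] t b by auto
  moreover have "f (p + q - b) \<le> t * f p + (1 - t) * f q"
    using convex_onD[OF f, of "1 - t" p q, unfolded real_scaleR_def compl_compl eqs] t b by auto
  ultimately show ?thesis by (simp add: algebra_simps)
qed

text \<open>Raising \<open>a\<close> to \<open>p + q - b\<close> makes the two sums equal, and monotonicity allows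
  this; what remains is the mirror inequality for \<open>b\<close> in the interval from \<open>p\<close> to
  \<open>q\<close>.  If \<open>b\<close> lies below \<open>p\<close>, then \<open>p\<close> dominates \<open>b\<close> and \<open>q\<close> dominates \<open>a\<close>.\<close>

lemma weakly_majorized_convex_mono:
  assumes f: "convex_on UNIV f" "mono f" and maj: "weakly_majorized a b p q"
  shows "weakly_majorized (f a) (f b) (f p) (f q)"
proof -
  have le: "a \<le> q" "b \<le> q" and sum: "a + b \<le> p + q"
    using maj by (simp_all add: weakly_majorized_def)
  have "f a + f b \<le> f p + f q"
  proof (cases "p \<le> b")
    case True
    have "f a \<le> f (p + q - b)" using f(2) sum by (simp add: monoD)
    moreover have "f (p + q - b) + f b \<le> f p + f q"
      using True le convex_on_subset[OF f(1)] by (intro convex_on_sum_mirror_le) auto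
    ultimately show ?thesis by simp
  next
    case False
    then have "f b \<le> f p" "f a \<le> f q" using f(2) le(1) by (simp_all add: monoD)
    then show ?thesis by simp
  qed
  then show ?thesis using f(2) le by (simp add: weakly_majorized_def monoD)
qed

section \<open>Layers preserve weak majorization\<close>

definition weakly_majorized_vec ::
    "nat \<Rightarrow> real vec \<Rightarrow> real vec \<Rightarrow> real vec \<Rightarrow> real vec \<Rightarrow> bool" where
  "weakly_majorized_vec N a b p q \<longleftrightarrow>
     {a, b, p, q} \<subseteq> carrier_vec N \<and>
     (\<forall>i<N. weakly_majorized (a $ i) (b $ i) (p $ i) (q $ i))"

lemma weakly_majorized_vec_inf_sup:
  assumes "x \<in> carrier_vec N" and "y \<in> carrier_vec N"
  shows "weakly_majorized_vec N x y (vec_inf x y) (vec_sup x y)"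
  using assms
  by (auto simp: weakly_majorized_vec_def vec_inf_def vec_sup_def weakly_majorized_min_max)

lemma weakly_majorized_vec_const:
  assumes "c \<in> carrier_vec N"
  shows "weakly_majorized_vec N c c c c"
  using assms by (simp add: weakly_majorized_vec_def weakly_majorized_const)

lemma weakly_majorized_vec_add:
  assumes "weakly_majorized_vec N a b p q" and "weakly_majorized_vec N a' b' p' q'"
  shows "weakly_majorized_vec N (a + a') (b + b') (p + p') (q + q')"
  using assms by (auto simp: weakly_majorized_vec_def intro!: weakly_majorized_add)

lemma weakly_majorized_vec_map:
  assumes "convex_on UNIV f" "mono f" and "weakly_majorized_vec N a b p q"
  shows "weakly_majorized_vec N (map_vec f a) (map_vec f b) (map_vec f p) (map_vec f q)"
  using assms(3)
  by (auto simp: weakly_majorized_vec_def weakly_majorized_convex_mono[OF assms(1,2)])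

lemma weakly_majorized_vec_mult_mat:
  assumes A: "A \<in> carrier_mat M N" and nonneg: "\<forall>w\<in>elements_mat A. 0 \<le> w"
    and maj: "weakly_majorized_vec N a b p q"
  shows "weakly_majorized_vec M (A *\<^sub>v a) (A *\<^sub>v b) (A *\<^sub>v p) (A *\<^sub>v q)"
proof -
  have entry: "(A *\<^sub>v v) $ i = (\<Sum>j = 0..<N. A $$ (i, j) * v $ j)"
    if "i < M" "v \<in> carrier_vec N" for i v
    using A that by (simp add: scalar_prod_def)
  have "weakly_majorized ((A *\<^sub>v a) $ i) ((A *\<^sub>v b) $ i) ((A *\<^sub>v p) $ i) ((A *\<^sub>v q) $ i)"
    if i: "i < M" for i
  proof -
    have "0 \<le> A $$ (i, j)" if "j < N" for j
      using A nonneg i that by (auto simp: elements_mat_def)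
    then show ?thesis
      using maj i
      by (auto simp: entry weakly_majorized_vec_def
          intro!: weakly_majorized_sum weakly_majorized_mult_left)
  qed
  then show ?thesis using A maj by (auto simp: weakly_majorized_vec_def)
qed

text \<open>Since each pre-activation adds the previous layer, a bias and the weighted input,
  the invariant of the previous layer must be combined with that of the input, which the
  skip term brings in again at every layer.\<close>

lemma weakly_majorized_vec_isnn_layer:
  assumes W1: "W 1 \<in> carrier_mat (m 1) N"
    and W: "\<forall>k\<in>{2..K}. W k \<in> carrier_mat (m k) (m (k - 1))"
    and D: "\<forall>k\<in>{2..K}. D k \<in> carrier_mat (m k) N"
    and b: "\<forall>k\<in>{1..K}. b k \<in> carrier_vec (m k)"
    and Wpos: "\<forall>k\<in>{1..K}. \<forall>w\<in>elements_mat (W k). 0 \<le> w"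
    and Dpos: "\<forall>k\<in>{2..K}. \<forall>d\<in>elements_mat (D k). 0 \<le> d"
    and \<sigma>: "convex_on UNIV \<sigma>" "mono \<sigma>"
    and maj: "weakly_majorized_vec N x y u v"
    and k: "1 \<le> k" "k \<le> K"
  shows "weakly_majorized_vec (m k) (isnn_layer \<sigma> W D b x k) (isnn_layer \<sigma> W D b y k)
           (isnn_layer \<sigma> W D b u k) (isnn_layer \<sigma> W D b v k)"
  using k
proof (induction k rule: dec_induct)
  case base
  have "weakly_majorized_vec (m 1)
          (W 1 *\<^sub>v x + b 1) (W 1 *\<^sub>v y + b 1) (W 1 *\<^sub>v u + b 1) (W 1 *\<^sub>v v + b 1)"
    using base b Wpos
    by (intro weakly_majorized_vec_add weakly_majorized_vec_const
        weakly_majorized_vec_mult_mat[OF W1 _ maj]) auto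
  from weakly_majorized_vec_map[OF \<sigma> this] show ?case by simp
next
  case (step k)
  from step.hyps obtain j where j: "k = Suc j" by (cases k) auto
  let ?l = "j + 2"
  have l: "?l \<in> {2..K}" "?l \<in> {1..K}" "?l - 1 = k" "Suc k = ?l"
    using step.prems j by auto
  have Wl: "W ?l \<in> carrier_mat (m ?l) (m k)" using W l by metis
  let ?pre = "\<lambda>x. W ?l *\<^sub>v isnn_layer \<sigma> W D b x k + b ?l + D ?l *\<^sub>v x"
  have "weakly_majorized_vec (m ?l) (?pre x) (?pre y) (?pre u) (?pre v)"
    using Wpos Dpos D b l step.IH step.prems
    by (intro weakly_majorized_vec_add weakly_majorized_vec_const
        weakly_majorized_vec_mult_mat[OF Wl]
        weakly_majorized_vec_mult_mat[OF _ _ maj]) auto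
  from weakly_majorized_vec_map[OF \<sigma> this] show ?case
    using l(4) by (simp add: j)
qed

section \<open>The output layer\<close>

text \<open>Linear functions are modular, whatever the signs of their coefficients.\<close>

lemma mult_mat_vec_sup_inf:
  assumes A: "A \<in> carrier_mat M N" and x: "x \<in> carrier_vec N" and y: "y \<in> carrier_vec N"
  shows "A *\<^sub>v x + A *\<^sub>v y = A *\<^sub>v vec_sup x y + A *\<^sub>v vec_inf x y"
proof -
  have c: "vec_sup x y \<in> carrier_vec N" "vec_inf x y \<in> carrier_vec N"
    using x by (auto simp: vec_sup_def vec_inf_def)
  have "x + y = vec_sup x y + vec_inf x y"
    using x y by (intro eq_vecI) (auto simp: vec_sup_def vec_inf_def)
  then show ?thesis
    by (simp flip: mult_add_distrib_mat_vec[OF A x y] mult_add_distrib_mat_vec[OF A c])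
qed

theorem proposition3:
  fixes n K :: nat
    and m :: "nat \<Rightarrow> nat"
    and \<sigma> :: "real \<Rightarrow> real"
    and W D :: "nat \<Rightarrow> real mat"
    and b :: "nat \<Rightarrow> real vec"
  assumes "n \<ge> 1" and "K \<ge> 1"
    and "W 1 \<in> carrier_mat (m 1) (2 * n)"
    and "\<forall>k\<in>{2..K}. W k \<in> carrier_mat (m k) (m (k - 1))"
    and "W (K + 1) \<in> carrier_mat 1 (m K)"
    and "\<forall>k\<in>{2..K}. D k \<in> carrier_mat (m k) (2 * n)"
    and "D (K + 1) \<in> carrier_mat 1 (2 * n)"
    and "\<forall>k\<in>{1..K}. b k \<in> carrier_vec (m k)"
    and "b (K + 1) \<in> carrier_vec 1"
    and "\<forall>k\<in>{1..K + 1}. \<forall>w\<in>elements_mat (W k). 0 \<le> w"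
    and "\<forall>k\<in>{2..K}. \<forall>d\<in>elements_mat (D k). 0 \<le> d"
    and "convex_on UNIV \<sigma>" and "mono \<sigma>"
  shows "supermodular_on (carrier_vec (2 * n)) (isnn K \<sigma> W D b)"
proof -
  have "isnn K \<sigma> W D b x + isnn K \<sigma> W D b y
      \<le> isnn K \<sigma> W D b (vec_sup x y) + isnn K \<sigma> W D b (vec_inf x y)"
    if x: "x \<in> carrier_vec (2 * n)" and y: "y \<in> carrier_vec (2 * n)" for x y
  proof -
    let ?z = "\<lambda>x. isnn_layer \<sigma> W D b x K"
    let ?a = "\<lambda>x. W (K + 1) *\<^sub>v ?z x + b (K + 1)"
    let ?d = "\<lambda>x. (D (K + 1) *\<^sub>v x) $ 0"
    have "weakly_majorized_vec (m K) (?z x) (?z y) (?z (vec_inf x y)) (?z (vec_sup x y))"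
      using assms weakly_majorized_vec_inf_sup[OF x y]
      by (intro weakly_majorized_vec_isnn_layer[where N = "2 * n"]) auto
    then have "weakly_majorized_vec 1 (?a x) (?a y) (?a (vec_inf x y)) (?a (vec_sup x y))"
      using assms
      by (intro weakly_majorized_vec_add weakly_majorized_vec_const
          weakly_majorized_vec_mult_mat[where N = "m K"]) auto
    then have "?a x $ 0 + ?a y $ 0 \<le> ?a (vec_inf x y) $ 0 + ?a (vec_sup x y) $ 0"
      by (simp add: weakly_majorized_vec_def weakly_majorized_def)
    moreover have "?d x + ?d y = ?d (vec_sup x y) + ?d (vec_inf x y)"
      using arg_cong[OF mult_mat_vec_sup_inf[OF assms(7) x y], of "\<lambda>v. v $ 0"] assms(7)
      by simp
    moreover have "isnn K \<sigma> W D b v = ?a v $ 0 + ?d v" for v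
      using assms(7) by (simp add: isnn_def)
    ultimately show ?thesis by simp
  qed
  then show ?thesis by (simp add: supermodular_on_def)
qed

end
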